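(* Let $n \geq 3$ and let $p(z)=\sum_{j=0}^{n} a_j z^j$ be a real polynomial with positive coefficients $a_0,\dots,a_n>0$. Then the following holds. (a) If $$\gamma_2=\max\left\{\frac{a_{n-1}}{a_n},\frac{a_{n-2}}{a_{n-1}}\right\},\quad \gamma_1=0,\quad \gamma_0=\max\left\{0,\ \max_{0\leq j\leq n-3}\frac{a_j-\gamma_2 a_{j+1}}{a_{j+3}}\right\},$$ or if $$\gamma_2=\frac{a_{n-1}}{a_n},\quad \gamma_1=\frac{a_{n-2}-\gamma_2 a_{n-1}}{a_n},$$ $$\gamma_0=\max\left\{0,\ \frac{\gamma_1 a_0}{-a_1},\ \frac{\gamma_2 a_0+\gamma_1 a_1}{-a_2},\ \max_{0\leq j\leq n-3}\frac{a_j-\gamma_2 a_{j+1}-\gamma_1 a_{j+2}}{a_{j+3}}\right\},$$ then all the zeros of $p$ lie in the closed disk $\{z\in\mathbb{C}:|z|\leq r_1\}$, where $r_1$ is the unique positive zero of $z^3-\gamma_2 z^2-\gamma_1 z-\gamma_0$. (b) If $$\delta_2=\max\left\{\frac{a_1}{a_0},\frac{a_2}{a_1}\right\},\quad \delta_1=0,\quad \delta_0=\max\left\{0,\ \max_{0\leq j\leq n-3}\frac{a_{j+3}-\delta_2 a_{j+2}}{a_j}\right\},$$ or if $$\delta_2=\frac{a_1}{a_0},\quad \delta_1=\frac{a_2-\delta_2 a_1}{a_0},$$ $$\delta_0=\max\left\{0,\ \frac{\delta_1 a_n}{-a_{n-1}},\ \frac{\delta_2 a_n+\delta_1 a_{n-1}}{-a_{n-2}},\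 \max_{0\leq j\leq n-3}\frac{a_{j+3}-\delta_2 a_{j+2}-\delta_1 a_{j+1}}{a_j}\right\},$$ then no zero of $p$ lies in the open disk $\{z\in\mathbb{C}:|z|<1/r_2\}$, where $r_2$ is the unique positive zero of $z^3-\delta_2 z^2-\delta_1 z-\delta_0$.
   Context: Zeros are complex zeros. In each part, either of the two listed choices of the three parameters may be used, and the conclusion holds for each choice. *)

theory Defs
  imports Complex_Main "HOL-Computational_Algebra.Polynomial"
begin

definition unique_positive_zero :: "(real \<Rightarrow> real) \<Rightarrow> real \<Rightarrow> bool" where
  "unique_positive_zero f r \<longleftrightarrow> r > 0 \<and> f r = 0 \<and> (\<forall>s>0. f s = 0 \<longrightarrow> s = r)"

end

theory Submission
  imports Defs
begin

text \<open>
  The engine is the classical Cauchy argument: a real polynomial whose leading coefficient is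
  positive and whose other coefficients are all nonpositive has at most one positive zero, and such
  a zero bounds the modulus of every complex zero (\<open>Cauchy_zero_bound\<close>).

  A polynomial \<open>p\<close> with positive coefficients is far from this shape, but it can be brought to it by
  multiplication with a monic cubic \<open>q(x) = x^3 - g2 x^2 - g1 x - g0\<close>. The coefficient of \<open>x^(j+3)\<close> in
  \<open>q p\<close>, for \<open>-3 \<le> j < n\<close>, is \<open>a j - g2 a (j+1) - g1 a (j+2) - g0 a (j+3)\<close>, where \<open>a\<close> is continued by zero outside
  \<open>{0..n}\<close>. The formulas for the parameters make these numbers nonpositive: \<open>g2\<close> and \<open>g1\<close> take care
  of the two coefficients just below the leading one, in which \<open>g0\<close> does not occur, and \<open>g0\<close> is the
  smallest nonnegative number that takes care of the rest. Since \<open>p\<close> is positive on the positive axis,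
  the positive zeros of \<open>q p\<close> are those of \<open>q\<close>, so that the Cauchy bound of \<open>q p\<close> is the positive zero
  of \<open>q\<close> (\<open>cubic_multiplier_zero_bound\<close>).

  The lower bound follows from the upper bound for the reversed polynomial \<open>z^n p(1/z)\<close>.
\<close>

section \<open>The Cauchy bound\<close>

text \<open>
  If \<open>s > r\<close>, then passing from \<open>r\<close> to \<open>s\<close> multiplies the leading term by \<open>(s/r)^n\<close> and every other
  term by at most \<open>(s/r)^(n-1)\<close>. So the leading term, which balances the others at \<open>r\<close>, outweighs
  them at every point of modulus \<open>s\<close>.
\<close>
lemma Cauchy_zero_bound:
  fixes P :: "real poly" and z :: complex
  assumes lead: "lead_coeff P > 0"
    and lower: "\<And>k. k < degree P \<Longrightarrow> coeff P k \<le> 0"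
    and "r > 0" and zero_r: "poly P r = 0"
    and zero_z: "poly (map_poly complex_of_real P) z = 0"
  shows "cmod z \<le> r"
proof (rule ccontr)
  assume "\<not> cmod z \<le> r"
  then have "cmod z > r" by simp
  define N A t where "N = degree P" and "A = lead_coeff P" and "t = cmod z / r"
  have "t > 1" and z_eq: "cmod z = t * r"
    using \<open>cmod z > r\<close> \<open>r > 0\<close> by (auto simp: t_def)
  have "N > 0"
  proof (rule ccontr)
    assume "\<not> N > 0"
    then obtain c where "P = [:c:]"
      using degree_eq_zeroE unfolding N_def by blast
    with zero_r lead show False by simp
  qed
  have balance_r: "A * r ^ N = (\<Sum>k<N. - coeff P k * r ^ k)"
    using zero_r
    by (simp add: poly_altdef lessThan_Suc_atMost[symmetric] N_def[symmetric] A_def sum_negf)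
  have "of_real A * z ^ N = (\<Sum>k<N. of_real (- coeff P k) * z ^ k)"
    using zero_z
    by (simp add: poly_altdef lessThan_Suc_atMost[symmetric] N_def[symmetric] A_def sum_negf
        degree_map_poly coeff_map_poly add_eq_0_iff)
  then have "A * cmod z ^ N = cmod (\<Sum>k<N. of_real (- coeff P k) * z ^ k)"
    using lead by (metis A_def abs_of_pos norm_mult norm_of_real norm_power)
  also have "\<dots> \<le> (\<Sum>k<N. - coeff P k * cmod z ^ k)"
    by (rule sum_norm_le) (use lower in \<open>auto simp: norm_mult norm_power N_def\<close>)
  also have "\<dots> \<le> (\<Sum>k<N. t ^ (N - 1) * (- coeff P k * r ^ k))"
  proof (rule sum_mono)
    fix k assume "k \<in> {..<N}"
    then have "t ^ k \<le> t ^ (N - 1)" and "0 \<le> - coeff P k * r ^ k"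
      using \<open>t > 1\<close> lower \<open>r > 0\<close> by (auto simp: N_def mult_nonpos_nonneg intro: power_increasing)
    then have "t ^ k * (- coeff P k * r ^ k) \<le> t ^ (N - 1) * (- coeff P k * r ^ k)"
      by (rule mult_right_mono)
    then show "- coeff P k * cmod z ^ k \<le> t ^ (N - 1) * (- coeff P k * r ^ k)"
      by (simp add: z_eq power_mult_distrib mult_ac)
  qed
  also have "\<dots> = t ^ (N - 1) * (A * r ^ N)"
    by (simp only: balance_r sum_distrib_left)
  also have "\<dots> < t ^ N * (A * r ^ N)"
  proof (rule mult_strict_right_mono)
    show "t ^ (N - 1) < t ^ N"
      using \<open>t > 1\<close> \<open>N > 0\<close> by (intro power_strict_increasing) auto
  qed (use lead \<open>r > 0\<close> in \<open>simp add: A_def\<close>)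
  also have "\<dots> = A * cmod z ^ N"
    by (simp add: z_eq power_mult_distrib)
  finally show False by simp
qed

lemma poly_map_poly_of_real:
  "poly (map_poly complex_of_real P) (of_real x) = of_real (poly P x)"
  by (simp add: poly_altdef degree_map_poly coeff_map_poly)

text \<open>
  On the reals the Cauchy bound applies to both of two positive zeros, which makes them equal.
\<close>
lemma positive_zero_unique:
  fixes P :: "real poly"
  assumes "lead_coeff P > 0"
    and "\<And>k. k < degree P \<Longrightarrow> coeff P k \<le> 0"
    and "r > 0" "poly P r = 0" "s > 0" "poly P s = 0"
  shows "s = r"
proof -
  have "s' \<le> r'" if "r' > 0" "poly P r' = 0" "s' > 0" "poly P s' = 0" for r' s'
    using Cauchy_zero_bound[OF assms(1,2) that(1,2), of "of_real s'"] that(3,4)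
    by (simp add: poly_map_poly_of_real)
  with assms show ?thesis by (meson antisym)
qed

section \<open>Cubic multipliers\<close>

text \<open>
  The factor \<open>p\<close> has no zero on the positive axis, so \<open>q\<close> and \<open>q p\<close> have the same positive zeros, and
  the coefficients of \<open>q p\<close> permit at most one. The condition \<open>g2 > 0\<close> is there for its existence: it
  excludes \<open>q(x) = x^3\<close>.
\<close>
lemma cubic_multiplier_zero_bound:
  fixes p :: "real poly" and g2 g1 g0 :: real
  defines "q \<equiv> [:- g0, - g1, - g2, 1:]"
  assumes pos: "\<And>j. j \<le> degree p \<Longrightarrow> coeff p j > 0"
    and "g2 > 0"
    and lower: "\<And>k. k < degree p + 3 \<Longrightarrow> coeff (q * p) k \<le> 0"
  shows "\<exists>r. unique_positive_zero (\<lambda>x. x^3 - g2 * x^2 - g1 * x - g0) r \<and>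
    (\<forall>z. poly (map_poly complex_of_real p) z = 0 \<longrightarrow> cmod z \<le> r)"
proof -
  have "p \<noteq> 0" and "coeff p 0 > 0"
    using pos[of 0] by auto
  have deg: "degree (q * p) = degree p + 3"
    using \<open>p \<noteq> 0\<close> unfolding q_def by (subst degree_mult_eq) auto
  have lead: "lead_coeff (q * p) > 0"
    unfolding lead_coeff_mult using pos[of "degree p"] by (simp add: q_def)
  have q_eq: "poly q x = x^3 - g2 * x^2 - g1 * x - g0" for x
    by (simp add: q_def algebra_simps power2_eq_square power3_eq_cube)
  \<comment> \<open>A point where \<open>q\<close> is negative. The two lowest coefficients of \<open>q p\<close> give \<open>g0 \<ge> 0\<close> and, if \<open>g0 = 0\<close>,
    also \<open>g1 \<ge> 0\<close>. So 0 serves if \<open>g0 > 0\<close>; otherwise \<open>q(x) = x (x^2 - g2 x - g1)\<close> is negative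
    for \<open>0 < x < g2\<close>.\<close>
  obtain u where "u \<ge> 0" "u < 1 + g2 + \<bar>g1\<bar> + \<bar>g0\<bar>" "poly q u < 0"
  proof -
    have "coeff (q * p) 0 = - g0 * coeff p 0"
      by (simp add: q_def)
    with lower[of 0] have "g0 * coeff p 0 \<ge> 0" by simp
    then have "g0 \<ge> 0"
      using \<open>coeff p 0 > 0\<close> by (simp add: zero_le_mult_iff)
    then consider "g0 > 0" | "g0 = 0" by linarith
    then show thesis
    proof cases
      case 1
      with \<open>g2 > 0\<close> show ?thesis
        by (intro that[of 0]) (auto simp: q_eq)
    next
      case 2
      have "coeff (q * p) 1 = - g1 * coeff p 0"
        by (simp add: q_def 2)
      with lower[of 1] have "g1 * coeff p 0 \<ge> 0" by simp
      then have "g1 \<ge> 0"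
        using \<open>coeff p 0 > 0\<close> by (simp add: zero_le_mult_iff)
      have "poly q (g2 / 2) = - (g2 ^ 3 / 8 + g1 * g2 / 2)"
        by (simp add: q_eq 2 power2_eq_square power3_eq_cube field_simps)
      also have "\<dots> < 0"
        using \<open>g2 > 0\<close> \<open>g1 \<ge> 0\<close> by (simp only: neg_less_0_iff_less) (intro add_pos_nonneg; simp)
      finally show ?thesis
        using \<open>g2 > 0\<close> by (intro that[of "g2 / 2"]) auto
    qed
  qed
  moreover have "poly q (1 + g2 + \<bar>g1\<bar> + \<bar>g0\<bar>) > 0"
  proof -
    define b where "b = 1 + g2 + \<bar>g1\<bar> + \<bar>g0\<bar>"
    have "b \<ge> 1" using \<open>g2 > 0\<close> by (simp add: b_def)
    then have "b \<le> b ^ 2" "1 \<le> b ^ 2"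
      by (simp_all add: self_le_power one_le_power)
    have "g1 * b \<le> \<bar>g1\<bar> * b ^ 2"
      using \<open>b \<ge> 1\<close> \<open>b \<le> b ^ 2\<close> by (intro mult_mono) auto
    moreover have "g0 * 1 \<le> \<bar>g0\<bar> * b ^ 2"
      using \<open>1 \<le> b ^ 2\<close> by (intro mult_mono) auto
    moreover have "b ^ 3 = b ^ 2 + g2 * b ^ 2 + \<bar>g1\<bar> * b ^ 2 + \<bar>g0\<bar> * b ^ 2"
      by (subst power3_eq_cube, subst (1) b_def) (simp add: power2_eq_square algebra_simps)
    ultimately show ?thesis
      using \<open>1 \<le> b ^ 2\<close> unfolding b_def[symmetric] q_eq by linarith
  qed
  ultimately obtain r where "r > u" "poly q r = 0"
    using poly_IVT_pos by blast
  then have "r > 0" using \<open>u \<ge> 0\<close> by simp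
  have "s = r" if "s > 0" "poly q s = 0" for s
    by (rule positive_zero_unique[of "q * p"])
      (use lead lower deg that \<open>r > 0\<close> \<open>poly q r = 0\<close> in auto)
  then have "unique_positive_zero (\<lambda>x. x^3 - g2 * x^2 - g1 * x - g0) r"
    using \<open>r > 0\<close> \<open>poly q r = 0\<close> unfolding unique_positive_zero_def q_eq by blast
  moreover have "cmod z \<le> r" if "poly (map_poly complex_of_real p) z = 0" for z
  proof (rule Cauchy_zero_bound[of "q * p"])
    have "map_poly complex_of_real (q * p)
        = map_poly complex_of_real q * map_poly complex_of_real p"
      by (intro poly_eqI) (simp add: coeff_map_poly coeff_mult)
    with that show "poly (map_poly complex_of_real (q * p)) z = 0" by simp
  qed (use lead lower deg \<open>r > 0\<close> \<open>poly q r = 0\<close> in auto)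
  ultimately show ?thesis by blast
qed

section \<open>Sign conditions from the choice of parameters\<close>

lemma coeff_sum_monom:
  fixes a :: "nat \<Rightarrow> real"
  shows "coeff (\<Sum>j\<le>n. monom (a j) j) k = (if k \<le> n then a k else 0)"
  by (simp add: coeff_sum coeff_monom sum.delta)

lemma degree_sum_monom:
  fixes a :: "nat \<Rightarrow> real"
  assumes "a n \<noteq> 0"
  shows "degree (\<Sum>j\<le>n. monom (a j) j) = n"
  using assms by (intro antisym le_degree degree_le) (auto simp: coeff_sum_monom)

text \<open>
  The hypotheses are the signs of the coefficients of \<open>q p\<close>; the coefficients at both ends of \<open>q p\<close>
  are listed separately because some of the four terms are missing there.
\<close>
lemma zero_bound_if_recurrence_majorized:
  fixes a :: "nat \<Rightarrow> real" and g2 g1 g0 :: real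
  assumes "n \<ge> 3" and pos: "\<forall>j\<le>n. a j > 0" and "g2 > 0" and "g0 \<ge> 0"
    and low1: "0 \<le> g1 * a 0 + g0 * a 1"
    and low2: "0 \<le> g2 * a 0 + g1 * a 1 + g0 * a 2"
    and mid: "\<And>j. j \<le> n - 3 \<Longrightarrow> a j \<le> g2 * a (j+1) + g1 * a (j+2) + g0 * a (j+3)"
    and high1: "a (n-2) \<le> g2 * a (n-1) + g1 * a n"
    and high2: "a (n-1) \<le> g2 * a n"
  shows "\<exists>r. unique_positive_zero (\<lambda>x. x^3 - g2 * x^2 - g1 * x - g0) r \<and>
    (\<forall>z. poly (map_poly complex_of_real (\<Sum>j\<le>n. monom (a j) j)) z = 0 \<longrightarrow> cmod z \<le> r)"
proof (rule cubic_multiplier_zero_bound)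
  let ?p = "\<Sum>j\<le>n. monom (a j) j"
  have deg: "degree ?p = n"
    using pos by (intro degree_sum_monom) (metis order_refl less_irrefl)
  show "coeff ?p j > 0" if "j \<le> degree ?p" for j
    using that pos by (simp add: deg coeff_sum_monom)
  show "coeff ([:- g0, - g1, - g2, 1:] * ?p) k \<le> 0" if "k < degree ?p + 3" for k
  proof -
    consider "k = 0" | "k = 1" | "k = 2" | j where "k = j + 3"
      by (metis One_nat_def Suc_1 add.commute add_2_eq_Suc not0_implies_Suc numeral_3_eq_3 add_Suc_right)
    then show ?thesis
    proof cases
      case 1
      then show ?thesis using \<open>g0 \<ge> 0\<close> pos by (simp add: coeff_sum_monom less_imp_le)
    next
      case 2
      then show ?thesis using low1 \<open>n \<ge> 3\<close> by (simp add: coeff_sum_monom)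
    next
      case 3
      then show ?thesis using low2 \<open>n \<ge> 3\<close>
        by (simp add: coeff_sum_monom numeral_2_eq_2)
    next
      case (4 j)
      have coeff_eq: "coeff ([:- g0, - g1, - g2, 1:] * ?p) (j + 3) =
          coeff ?p j - g2 * coeff ?p (j+1) - g1 * coeff ?p (j+2) - g0 * coeff ?p (j+3)"
        by (simp add: numeral_2_eq_2 numeral_3_eq_3)
      from 4 that have "j < n" by (simp add: deg)
      then consider "j \<le> n - 3" | "j = n - 2" | "j = n - 1" using \<open>n \<ge> 3\<close> by linarith
      then have "coeff ?p j - g2 * coeff ?p (j+1) - g1 * coeff ?p (j+2) - g0 * coeff ?p (j+3) \<le> 0"
      proof cases
        case 1
        with \<open>n \<ge> 3\<close> have "j + 1 \<le> n" "j + 2 \<le> n" "j + 3 \<le> n" by auto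
        with mid[OF 1] show ?thesis by (simp add: coeff_sum_monom)
      next
        case 2
        with \<open>n \<ge> 3\<close> have "j + 1 = n - 1" "j + 2 = n" by auto
        with 2 high1 \<open>n \<ge> 3\<close> show ?thesis by (simp add: coeff_sum_monom)
      next
        case 3
        with \<open>n \<ge> 3\<close> have "j + 1 = n" by auto
        with 3 high2 \<open>n \<ge> 3\<close> show ?thesis by (simp add: coeff_sum_monom)
      qed
      then show ?thesis using coeff_eq 4 by simp
    qed
  qed
qed (fact \<open>g2 > 0\<close>)

text \<open>
  Each entry of the maxima is one of the sign conditions on \<open>q p\<close>, solved for \<open>g2\<close> or \<open>g0\<close>. For
  \<open>g1 = 0\<close> the conditions on the coefficients of \<open>x\<close> and \<open>x^2\<close> have no entry, since they hold for all
  \<open>g2, g0 \<ge> 0\<close>. In the other choice, \<open>g2\<close> and \<open>g1\<close> make the two coefficients just below the leading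
  one vanish.
\<close>
lemma zero_bound_max_parameters:
  fixes a :: "nat \<Rightarrow> real" and g2 g1 g0 :: real
  assumes n: "n \<ge> 3" and pos: "\<forall>j\<le>n. a j > 0"
    and params: "(g2 = Max {a (n-1) / a n, a (n-2) / a (n-1)} \<and>
         g1 = 0 \<and>
         g0 = Max {0, MAX j\<in>{0..n-3}. (a j - g2 * a (j+1)) / a (j+3)})
        \<or>
        (g2 = a (n-1) / a n \<and>
         g1 = (a (n-2) - g2 * a (n-1)) / a n \<and>
         g0 = Max {0, g1 * a 0 / (- a 1), (g2 * a 0 + g1 * a 1) / (- a 2),
                  MAX j\<in>{0..n-3}. (a j - g2 * a (j+1) - g1 * a (j+2)) / a (j+3)})"
  shows "\<exists>r. unique_positive_zero (\<lambda>x. x^3 - g2 * x^2 - g1 * x - g0) r \<and>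
    (\<forall>z. poly (map_poly complex_of_real (\<Sum>j\<le>n. monom (a j) j)) z = 0 \<longrightarrow> cmod z \<le> r)"
proof -
  have pos': "a 0 > 0" "a 1 > 0" "a 2 > 0" "a (n-2) > 0" "a (n-1) > 0" "a n > 0"
    using n pos by auto
  have pos_from_3: "a (j + 3) > 0" if "j \<le> n - 3" for j
    using that n pos by auto
  from params show ?thesis
  proof (elim disjE conjE)
    assume g2: "g2 = Max {a (n-1) / a n, a (n-2) / a (n-1)}" and g1: "g1 = 0"
      and g0: "g0 = Max {0, MAX j\<in>{0..n-3}. (a j - g2 * a (j+1)) / a (j+3)}"
    have "g0 \<ge> 0" by (simp add: g0)
    have "a (n-1) / a n \<le> g2" "a (n-2) / a (n-1) \<le> g2" by (simp_all add: g2)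
    moreover from this(1) have "g2 > 0" using pos' by (smt (verit) divide_pos_pos)
    moreover have "(a j - g2 * a (j+1)) / a (j+3) \<le> g0" if "j \<le> n - 3" for j
    proof -
      have "(a j - g2 * a (j+1)) / a (j+3) \<le> (MAX j\<in>{0..n-3}. (a j - g2 * a (j+1)) / a (j+3))"
        using that by (intro Max_ge) auto
      also have "\<dots> \<le> g0" by (simp add: g0)
      finally show ?thesis .
    qed
    ultimately show ?thesis
      using pos' \<open>g0 \<ge> 0\<close> pos_from_3
      by (intro zero_bound_if_recurrence_majorized[OF n pos])
        (simp_all add: g1 pos_divide_le_eq diff_le_eq algebra_simps)
  next
    assume g2: "g2 = a (n-1) / a n" and g1: "g1 = (a (n-2) - g2 * a (n-1)) / a n"
      and g0: "g0 = Max {0, g1 * a 0 / (- a 1), (g2 * a 0 + g1 * a 1) / (- a 2),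
                  MAX j\<in>{0..n-3}. (a j - g2 * a (j+1) - g1 * a (j+2)) / a (j+3)}"
    have "g0 \<ge> 0" "g1 * a 0 / (- a 1) \<le> g0" "(g2 * a 0 + g1 * a 1) / (- a 2) \<le> g0"
      unfolding g0 by (rule Max_ge; simp)+
    moreover have "g2 > 0" using pos' by (simp add: g2)
    moreover have "g2 * a n = a (n-1)" using pos' by (simp add: g2)
    moreover have "g1 * a n = a (n-2) - g2 * a (n-1)" using pos' by (simp add: g1)
    moreover have "(a j - g2 * a (j+1) - g1 * a (j+2)) / a (j+3) \<le> g0" if "j \<le> n - 3" for j
    proof -
      have "(a j - g2 * a (j+1) - g1 * a (j+2)) / a (j+3)
          \<le> (MAX j\<in>{0..n-3}. (a j - g2 * a (j+1) - g1 * a (j+2)) / a (j+3))"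
        using that by (intro Max_ge) auto
      also have "\<dots> \<le> g0" unfolding g0 by (rule Max_ge; simp)
      finally show ?thesis .
    qed
    ultimately show ?thesis
      using pos' pos_from_3
      by (intro zero_bound_if_recurrence_majorized[OF n pos]) (simp_all add: field_simps)
  qed
qed

section \<open>Reversal\<close>

lemma image_reversed_interval:
  fixes f g :: "nat \<Rightarrow> 'a"
  assumes "\<And>j. j \<le> m \<Longrightarrow> f j = g (m - j)"
  shows "f ` {0..m} = g ` {0..m}"
proof -
  have "f ` {0..m} = (\<lambda>j. g (m - j)) ` {0..m}"
    using assms by (intro image_cong) auto
  also have "\<dots> = g ` ((\<lambda>j. m - j) ` {0..m})"
    by (simp add: image_image)
  also have "(\<lambda>j. m - j) ` {0..m} = {0..m}"
  proof (intro equalityI subsetI)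
    fix j assume "j \<in> {0..m}"
    then show "j \<in> (\<lambda>j. m - j) ` {0..m}"
      by (intro image_eqI[of _ _ "m - j"]) auto
  qed auto
  finally show ?thesis .
qed

lemma poly_reversed_sum_monom:
  fixes a :: "nat \<Rightarrow> real" and z :: complex
  assumes "z \<noteq> 0"
  shows "poly (map_poly complex_of_real (\<Sum>j\<le>n. monom (a (n - j)) j)) (inverse z)
    = inverse z ^ n * poly (map_poly complex_of_real (\<Sum>j\<le>n. monom (a j) j)) z"
proof -
  have eval: "poly (map_poly complex_of_real (\<Sum>j\<le>n. monom (b j) j)) w
      = (\<Sum>j\<le>n. of_real (b j) * w ^ j)" for b :: "nat \<Rightarrow> real" and w
  proof -
    have "map_poly complex_of_real (\<Sum>j\<le>n. monom (b j) j) = (\<Sum>j\<le>n. monom (of_real (b j)) j)"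
      by (intro poly_eqI) (simp add: coeff_map_poly coeff_sum coeff_monom if_distrib sum.delta)
    then show ?thesis by (simp add: poly_sum poly_monom)
  qed
  have "(\<Sum>j\<le>n. of_real (a (n - j)) * inverse z ^ j)
      = (\<Sum>j\<le>n. of_real (a j) * inverse z ^ (n - j))"
    by (rule sum.reindex_bij_witness[of _ "\<lambda>j. n - j" "\<lambda>j. n - j"]) auto
  also have "\<dots> = (\<Sum>j\<le>n. inverse z ^ n * (of_real (a j) * z ^ j))"
    by (rule sum.cong) (use assms in \<open>auto simp: power_diff field_simps\<close>)
  finally show ?thesis by (simp add: eval sum_distrib_left)
qed

theorem theorem3p3:
  fixes n :: nat and a :: "nat \<Rightarrow> real" and p :: "real poly"
  assumes "n \<ge> 3"
    and "\<forall>j\<le>n. a j > 0"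
    and "p = (\<Sum>j\<le>n. monom (a j) j)"
  shows
    "(\<forall>\<gamma>\<^sub>2 \<gamma>\<^sub>1 \<gamma>\<^sub>0.
        (\<gamma>\<^sub>2 = Max {a (n-1) / a n, a (n-2) / a (n-1)} \<and>
         \<gamma>\<^sub>1 = 0 \<and>
         \<gamma>\<^sub>0 = Max {0, MAX j\<in>{0..n-3}. (a j - \<gamma>\<^sub>2 * a (j+1)) / a (j+3)})
        \<or>
        (\<gamma>\<^sub>2 = a (n-1) / a n \<and>
         \<gamma>\<^sub>1 = (a (n-2) - \<gamma>\<^sub>2 * a (n-1)) / a n \<and>
         \<gamma>\<^sub>0 = Max {0, \<gamma>\<^sub>1 * a 0 / (- a 1), (\<gamma>\<^sub>2 * a 0 + \<gamma>\<^sub>1 * a 1) / (- a 2),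
                  MAX j\<in>{0..n-3}. (a j - \<gamma>\<^sub>2 * a (j+1) - \<gamma>\<^sub>1 * a (j+2)) / a (j+3)})
        \<longrightarrow>
        (\<exists>r\<^sub>1. unique_positive_zero (\<lambda>x. x^3 - \<gamma>\<^sub>2 * x^2 - \<gamma>\<^sub>1 * x - \<gamma>\<^sub>0) r\<^sub>1 \<and>
              (\<forall>z::complex. poly (map_poly complex_of_real p) z = 0 \<longrightarrow> cmod z \<le> r\<^sub>1)))
     \<and>
     (\<forall>\<delta>\<^sub>2 \<delta>\<^sub>1 \<delta>\<^sub>0.
        (\<delta>\<^sub>2 = Max {a 1 / a 0, a 2 / a 1} \<and>
         \<delta>\<^sub>1 = 0 \<and>
         \<delta>\<^sub>0 = Max {0, MAX j\<in>{0..n-3}. (a (j+3) - \<delta>\<^sub>2 * a (j+2)) / a j})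
        \<or>
        (\<delta>\<^sub>2 = a 1 / a 0 \<and>
         \<delta>\<^sub>1 = (a 2 - \<delta>\<^sub>2 * a 1) / a 0 \<and>
         \<delta>\<^sub>0 = Max {0, \<delta>\<^sub>1 * a n / (- a (n-1)), (\<delta>\<^sub>2 * a n + \<delta>\<^sub>1 * a (n-1)) / (- a (n-2)),
                  MAX j\<in>{0..n-3}. (a (j+3) - \<delta>\<^sub>2 * a (j+2) - \<delta>\<^sub>1 * a (j+1)) / a j})
        \<longrightarrow>
        (\<exists>r\<^sub>2. unique_positive_zero (\<lambda>x. x^3 - \<delta>\<^sub>2 * x^2 - \<delta>\<^sub>1 * x - \<delta>\<^sub>0) r\<^sub>2 \<and>
              (\<forall>z::complex. cmod z < 1 / r\<^sub>2 \<longrightarrow> poly (map_poly complex_of_real p) z \<noteq> 0)))"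
proof (intro conjI allI impI, goal_cases)
  case (1 g2 g1 g0)
  show ?case
    using zero_bound_max_parameters[OF assms(1,2) 1] assms(3) by simp
next
  case (2 d2 d1 d0)
  \<comment> \<open>The parameters are those of the upper bound for the reversed polynomial.\<close>
  define b where "b j = a (n - j)" for j
  have b_ends: "b n = a 0" "b (n-1) = a 1" "b (n-2) = a 2" "b 0 = a n" "b 1 = a (n-1)" "b 2 = a (n-2)"
    using assms(1) by (simp_all add: b_def)
  have index: "n - (n - 3 - j) = j + 3" "n - (n - 3 - j + 1) = j + 2" "n - (n - 3 - j + 2) = j + 1"
    "n - (n - 3 - j + 3) = j" if "j \<le> n - 3" for j
    using that assms(1) by auto
  have max_rev: "(\<lambda>j. (a (j+3) - d2 * a (j+2)) / a j) ` {0..n-3}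
      = (\<lambda>j. (b j - d2 * b (j+1)) / b (j+3)) ` {0..n-3}"
    "(\<lambda>j. (a (j+3) - d2 * a (j+2) - d1 * a (j+1)) / a j) ` {0..n-3}
      = (\<lambda>j. (b j - d2 * b (j+1) - d1 * b (j+2)) / b (j+3)) ` {0..n-3}"
    by (rule image_reversed_interval; simp only: b_def index)+
  have b_pos: "\<forall>j\<le>n. b j > 0"
    using assms(2) by (simp add: b_def)
  obtain r where r: "unique_positive_zero (\<lambda>x. x^3 - d2 * x^2 - d1 * x - d0) r"
    and bound: "\<And>z. poly (map_poly complex_of_real (\<Sum>j\<le>n. monom (b j) j)) z = 0 \<Longrightarrow> cmod z \<le> r"
    using zero_bound_max_parameters[OF assms(1) b_pos, of d2 d1 d0] 2
    unfolding b_ends max_rev by blast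
  have "r > 0" using r by (simp add: unique_positive_zero_def)
  have "poly (map_poly complex_of_real p) z \<noteq> 0" if "cmod z < 1 / r" for z
  proof
    assume zero: "poly (map_poly complex_of_real p) z = 0"
    have "z \<noteq> 0"
    proof
      assume "z = 0"
      with zero have "coeff p 0 = 0" by (simp add: poly_0_coeff_0 coeff_map_poly)
      then have "a 0 = 0" by (simp add: assms(3) coeff_sum_monom)
      moreover have "a 0 > 0" using assms(2) by blast
      ultimately show False by simp
    qed
    then have "cmod (inverse z) \<le> r"
      using zero poly_reversed_sum_monom[of z a n] by (intro bound) (simp add: b_def assms(3))
    then show False
      using that \<open>z \<noteq> 0\<close> \<open>r > 0\<close> by (simp add: norm_inverse norm_divide field_simps)
  qed
  with r show ?case by blast
qed

end
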